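(* (1) There exist $2^{\aleph_0}$ complete folding sequences which are pairwise not locally isomorphic. (2) For each complete folding sequence $S$, there exist $2^{\aleph_0}$ isomorphism classes of sequences $(b_h)_{h\in\mathbb{Z}}\subset\{+1,-1\}$ which are locally isomorphic to $S$.
   Context: All sequences take values in $\{+1,-1\}$. For $S=(a_1,\dots,a_n)$ write $\overline{S}=(-a_n,\dots,-a_1)$. The $n$-folding sequences are defined recursively: the only $0$-folding sequence is the empty sequence, and the $(n+1)$-folding sequences are exactly $(\overline{S},+1,S)$ and $(\overline{S},-1,S)$ with $S$ an $n$-folding sequence. A finite sequence $(u_1,\dots,u_m)$ is a subword of a sequence $(b_k)$ if there is $h$ with $u_k=b_{k+h}$ for $1\le k\le m$. A complete folding sequence is a sequence $(a_k)_{k\in\mathbb{Z}}$ each finite subword of which is a subword of some $n$-folding sequence. Two sequences $(a_h)_{h\in\mathbb{Z}},(b_h)_{h\in\mathbb{Z}}$ are isomorphic if there is $k\in\mathbb{Z}$ with $b_h=a_{h+k}$ for all $h$, and locally isomorphic if they have the same finite subwords. *)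

theory Defs
  imports Complex_Main "HOL-Library.Sublist" "HOL-Library.Equipollence"
begin

definition fold_bar :: "int list \<Rightarrow> int list" where
  "fold_bar S = map uminus (rev S)"

primrec folding_sequences :: "nat \<Rightarrow> int list set" where
  "folding_sequences 0 = {[]}"
| "folding_sequences (Suc n) =
     {fold_bar S @ [e] @ S | S e. S \<in> folding_sequences n \<and> e \<in> {1, -1}}"

definition sign_sequences :: "(int \<Rightarrow> int) set" where
  "sign_sequences = {a. range a \<subseteq> {1, -1}}"

text \<open>Subwords of finite sequences are given by \<^const>\<open>sublist\<close>; the next definition is the
  corresponding notion for sequences indexed by the integers. Lists are indexed from 0, which
  only changes the shift \<open>h\<close>.\<close>

definition subword :: "int list \<Rightarrow> (int \<Rightarrow> int) \<Rightarrow> bool" where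
  "subword u b \<longleftrightarrow> (\<exists>h::int. \<forall>k<length u. u ! k = b (int k + h))"

definition complete_folding_sequence :: "(int \<Rightarrow> int) \<Rightarrow> bool" where
  "complete_folding_sequence a \<longleftrightarrow> a \<in> sign_sequences \<and>
     (\<forall>u. subword u a \<longrightarrow> (\<exists>n. \<exists>S\<in>folding_sequences n. sublist u S))"

definition isomorphic_rel :: "((int \<Rightarrow> int) \<times> (int \<Rightarrow> int)) set" where
  "isomorphic_rel = {(a, b). \<exists>k::int. \<forall>h. b h = a (h + k)}"

definition locally_isomorphic :: "(int \<Rightarrow> int) \<Rightarrow> (int \<Rightarrow> int) \<Rightarrow> bool" where
  "locally_isomorphic a b \<longleftrightarrow> (\<forall>u. subword u a \<longleftrightarrow> subword u b)"

end

theory Submission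
  imports Defs "HOL-Library.Nat_Bijection"
begin

text \<open>A complete folding sequence is a Toeplitz sequence: there are a 2-adic integer \<open>x\<close> and signs
  \<open>\<eta> j\<close> with \<open>a (x + 2 ^ j * (2 * m + 1)) = (-1) ^ m * \<eta> j\<close>, which determines \<open>a\<close> except possibly
  at \<open>k = x\<close>. The signs \<open>\<eta>\<close> are exactly the local isomorphism invariant, and shifting \<open>a\<close> by an
  integer shifts \<open>x\<close>. So the continuum of choices of \<open>\<eta>\<close> gives (1), and for fixed \<open>\<eta>\<close> a continuum
  of centres \<open>x\<close> that differ pairwise by non-integers gives (2).\<close>

text \<open>The 2-adic centre is represented by integers \<open>x n\<close>, of which only the residue modulo \<open>2 ^ n\<close>
  matters; the value at \<open>x + 2 ^ j * (2 * m + 1)\<close> depends on \<open>x\<close> modulo \<open>2 ^ (j + 2)\<close>.\<close>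

definition fold_structure :: "(nat \<Rightarrow> int) \<Rightarrow> (nat \<Rightarrow> int) \<Rightarrow> (int \<Rightarrow> int) \<Rightarrow> bool" where
  "fold_structure \<eta> x a \<longleftrightarrow> range \<eta> \<subseteq> {1, -1} \<and> (\<forall>n. 2 ^ n dvd x (Suc n) - x n) \<and>
     a \<in> sign_sequences \<and>
     (\<forall>j m. a (x (j + 2) + 2 ^ j * (2 * m + 1)) = (if even m then \<eta> j else - \<eta> j))"

section \<open>Coherent centres, and existence of a structure with given signs and centre\<close>

lemma coherent_dvd:
  fixes x :: "nat \<Rightarrow> int"
  assumes "\<forall>n. 2 ^ n dvd x (Suc n) - x n" and "n \<le> N"
  shows "2 ^ n dvd x N - x n"
  using assms(2)
proof (induction N rule: dec_induct)
  case (step i)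
  have "(2::int) ^ n dvd x (Suc i) - x i"
    using assms(1) step.hyps(1) by (meson dvd_trans le_imp_power_dvd)
  with step.IH show ?case
    by (metis diff_add_cancel dvd_add add_diff_eq)
qed simp

lemma fold_structure_sign:
  assumes "fold_structure \<eta> x a"
  shows "\<eta> j = 1 \<or> \<eta> j = -1" and "a k = 1 \<or> a k = -1"
  using assms by (auto simp: fold_structure_def sign_sequences_def image_subset_iff)

lemma fold_structure_dvd:
  assumes "fold_structure \<eta> x a" and "n \<le> N"
  shows "2 ^ n dvd x N - x n"
  using assms coherent_dvd unfolding fold_structure_def by blast

text \<open>Replacing \<open>x (j + 2)\<close> by a finer approximation \<open>x n\<close> changes
  \<open>m\<close> by an even number, so the sign is unaffected.\<close>

lemma fold_structure_value:
  assumes "fold_structure \<eta> x a" and "j + 2 \<le> n" and k: "k = x n + 2 ^ j * (2 * m + 1)"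
  shows "a k = (if even m then \<eta> j else - \<eta> j)"
proof -
  obtain t where t: "x n - x (j + 2) = 2 ^ (j + 2) * t"
    using fold_structure_dvd[OF assms(1,2)] by (auto elim: dvdE)
  have "k = x (j + 2) + 2 ^ j * (2 * (m + 2 * t) + 1)"
    using t k by (simp add: algebra_simps power_add)
  then show ?thesis
    using assms(1) unfolding fold_structure_def by (metis dvd_triv_left even_add)
qed

lemma two_power_decompose:
  fixes z :: int
  assumes "\<not> 2 ^ n dvd z"
  obtains j m where "j < n" "z = 2 ^ j * (2 * m + 1)"
proof -
  have "\<exists>j<n. \<exists>m. z = 2 ^ j * (2 * m + 1)"
    using assms
  proof (induction n)
    case (Suc n)
    show ?case
    proof (cases "2 ^ n dvd z")
      case True
      then obtain w where w: "z = 2 ^ n * w" by blast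
      with Suc.prems have "odd w" by (auto simp: mult.commute)
      with w show ?thesis by (auto elim!: oddE)
    next
      case False
      with Suc.IH show ?thesis using less_Suc_eq by blast
    qed
  qed simp
  with that show ?thesis by blast
qed

text \<open>If \<open>j < j'\<close>, dividing by \<open>2 ^ j\<close> would equate an odd number
  with an even one. The term \<open>2 ^ Suc j * t\<close> leaves room for the difference of two
  approximations of one centre.\<close>

lemma two_power_decompose_unique:
  fixes m m' :: int
  assumes "2 ^ j * (2 * m + 1) - 2 ^ j' * (2 * m' + 1) = 2 ^ Suc j * t" and "j \<le> j'"
  shows "j = j'"
proof (rule ccontr)
  assume "j \<noteq> j'"
  with assms(2) obtain d where d: "j' = Suc j + d"
    using less_iff_Suc_add by (metis add_Suc le_neq_implies_less)
  have "2 ^ j * (2 * m + 1) = 2 ^ j * (2 * (2 ^ d * (2 * m' + 1) + t))"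
    using assms(1) unfolding d by (simp add: algebra_simps power_add)
  then have "2 * m + 1 = 2 * (2 ^ d * (2 * m' + 1) + t)" by simp
  then show False by presburger
qed

text \<open>The progressions for distinct pairs \<open>(j, m)\<close> never meet, so the prescribed
  values do not conflict. A point on no progression, which occurs when the centre is an integer, may
  take either sign.\<close>

lemma fold_structure_exists:
  assumes \<eta>: "range \<eta> \<subseteq> {1, -1}" and x: "\<forall>n. 2 ^ n dvd x (Suc n) - x n"
  shows "\<exists>a. fold_structure \<eta> x a"
proof -
  have uniq: "j = j' \<and> m = m'"
    if eq: "x (j + 2) + 2 ^ j * (2 * m + 1) = x (j' + 2) + 2 ^ j' * (2 * m' + 1)" for j j' m m'
  proof -
    have *: "j = j'" if le: "j \<le> j'"
      and eq: "x (j + 2) + 2 ^ j * (2 * m + 1) = x (j' + 2) + 2 ^ j' * (2 * m' + 1)" for j j' m m'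
    proof -
      have "2 ^ (j + 2) dvd x (j' + 2) - x (j + 2)"
        using le by (intro coherent_dvd[OF x]) simp
      then obtain t where "x (j' + 2) - x (j + 2) = 2 ^ (j + 2) * t" by blast
      with eq have "2 ^ j * (2 * m + 1) - 2 ^ j' * (2 * m' + 1) = 2 ^ Suc j * (2 * t)"
        by (simp add: algebra_simps)
      then show ?thesis using two_power_decompose_unique le by blast
    qed
    have "j = j'" using *[of j j'] *[of j' j] eq by (metis nat_le_linear)
    with eq show ?thesis by simp
  qed
  have "\<exists>v. v \<in> {1, -1} \<and> (\<forall>j m. k = x (j + 2) + 2 ^ j * (2 * m + 1) \<longrightarrow>
      v = (if even m then \<eta> j else - \<eta> j))" for k
  proof (cases "\<exists>j m. k = x (j + 2) + 2 ^ j * (2 * m + 1)")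
    case True
    then obtain j m where jm: "k = x (j + 2) + 2 ^ j * (2 * m + 1)" by blast
    show ?thesis
    proof (intro exI[of _ "if even m then \<eta> j else - \<eta> j"] conjI allI impI)
      show "(if even m then \<eta> j else - \<eta> j) \<in> {1, -1}"
        using \<eta> by (auto simp: image_subset_iff)
      fix j' m' assume "k = x (j' + 2) + 2 ^ j' * (2 * m' + 1)"
      with jm have "j = j' \<and> m = m'" by (intro uniq) simp
      then show "(if even m then \<eta> j else - \<eta> j) = (if even m' then \<eta> j' else - \<eta> j')" by simp
    qed
  qed auto
  then obtain a where "\<And>k. a k \<in> {1, -1} \<and> (\<forall>j m. k = x (j + 2) + 2 ^ j * (2 * m + 1) \<longrightarrow>
      a k = (if even m then \<eta> j else - \<eta> j))" by metis
  then show ?thesis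
    using assms unfolding fold_structure_def sign_sequences_def image_subset_iff by blast
qed

section \<open>Shifts, and local isomorphism of structures with equal signs\<close>

lemma fold_structure_shift:
  assumes "fold_structure \<eta> x a"
  shows "fold_structure \<eta> (\<lambda>n. x n - h) (\<lambda>k. a (k + h))"
  using assms unfolding fold_structure_def sign_sequences_def
  by (auto simp: algebra_simps image_subset_iff)

text \<open>The 2-adic valuation \<open>j\<close> of \<open>k - x (Suc n)\<close> is below
  \<open>n\<close>, and the value depends on this difference modulo \<open>2 ^ (j + 2)\<close> only.
  Since \<open>j + 2\<close> can be \<open>Suc n\<close>, the congruence needs one bit more than the
  non-divisibility.\<close>

lemma fold_structure_cong:
  assumes a: "fold_structure \<eta> x a" and b: "fold_structure \<eta> y b"
    and k: "\<not> 2 ^ n dvd k - x (Suc n)"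
    and k': "2 ^ Suc n dvd (k' - y (Suc n)) - (k - x (Suc n))"
  shows "b k' = a k"
proof -
  obtain j m where jm: "j < n" "k - x (Suc n) = 2 ^ j * (2 * m + 1)"
    using two_power_decompose[OF k] .
  obtain t where t: "(k' - y (Suc n)) - (k - x (Suc n)) = 2 ^ Suc n * t" using k' by blast
  obtain d where d: "n = Suc j + d" using jm(1) less_iff_Suc_add by auto
  have "k = x (Suc n) + 2 ^ j * (2 * m + 1)" using jm(2) by simp
  then have 1: "a k = (if even m then \<eta> j else - \<eta> j)"
    using fold_structure_value[OF a, of j "Suc n" k m] jm(1) by simp
  have "k' = y (Suc n) + 2 ^ j * (2 * (m + 2 * (2 ^ d * t)) + 1)"
    using t jm(2) unfolding d by (simp add: algebra_simps power_add)
  then have "b k' = (if even (m + 2 * (2 ^ d * t)) then \<eta> j else - \<eta> j)"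
    using jm(1) by (intro fold_structure_value[OF b, of j "Suc n"]) simp_all
  with 1 show ?thesis by simp
qed

text \<open>A short window meets at most one point \<open>k0\<close> close to the 2-adic centre \<open>x\<close>; every other
  value depends only on residues, and \<open>k0\<close> can be moved to a point near \<open>y\<close> with the right sign.\<close>

lemma fold_structure_window:
  assumes a: "fold_structure \<eta> x a" and b: "fold_structure \<eta> y b"
  shows "\<exists>h\<ge>c. \<forall>k\<in>{A..<A + int L}. b (k + h) = a k"
proof -
  \<comment> \<open>As \<open>L < 2 ^ L\<close>, at most one point of the window is congruent to the
    centre modulo \<open>2 ^ L\<close>. The extra bit is the one that
    \<open>fold_structure_cong\<close> asks for at the other points.\<close>
  define n where "n = Suc L"
  have L: "int L < 2 ^ L" using of_nat_less_two_power by blast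
  \<comment> \<open>Only the residue of the shift matters, so a multiple of the modulus can push it
    beyond \<open>c\<close>.\<close>
  have big: "z + 2 ^ e * \<bar>c - z\<bar> \<ge> c" for z :: int and e :: nat
  proof -
    have "1 * \<bar>c - z\<bar> \<le> 2 ^ e * \<bar>c - z\<bar>" by (intro mult_right_mono) auto
    moreover have "c - z \<le> \<bar>c - z\<bar>" by simp
    ultimately show ?thesis by (smt (verit))
  qed
  show ?thesis
  proof (cases "\<exists>k0\<in>{A..<A + int L}. 2 ^ n dvd k0 - x (Suc n)")
    case False
    define z where "z = y (Suc n) - x (Suc n)"
    define h where "h = z + 2 ^ Suc n * \<bar>c - z\<bar>"
    have "b (k + h) = a k" if "k \<in> {A..<A + int L}" for k
    proof (rule fold_structure_cong[OF a b])
      show "\<not> 2 ^ n dvd k - x (Suc n)" using False that by blast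
      have "k + h - y (Suc n) - (k - x (Suc n)) = 2 ^ Suc n * \<bar>c - z\<bar>"
        unfolding h_def z_def by simp
      then show "2 ^ Suc n dvd k + h - y (Suc n) - (k - x (Suc n))" by simp
    qed
    moreover have "h \<ge> c" unfolding h_def by (rule big)
    ultimately show ?thesis by blast
  next
    case True
    then obtain k0 where k0: "k0 \<in> {A..<A + int L}" "2 ^ n dvd k0 - x (Suc n)" by blast
    \<comment> \<open>The image of \<open>k0\<close> is given valuation exactly \<open>n\<close>
      relative to \<open>y\<close>. The parity of \<open>e\<close> selects the sign, and the free
      \<open>q\<close> allows the shift to be enlarged.\<close>
    obtain e :: int where e: "b (y (n + 2) + 2 ^ n * (2 * (e + 2 * q) + 1)) = a k0" for q
    proof (cases "a k0 = \<eta> n")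
      case True
      show ?thesis
        by (rule that[of 0]) (subst fold_structure_value[OF b _ refl], use True in simp_all)
    next
      case False
      then have "a k0 = - \<eta> n" using fold_structure_sign(1)[OF a, of n] fold_structure_sign(2)[OF a, of k0] by auto
      then show ?thesis
        by (intro that[of 1]) (subst fold_structure_value[OF b _ refl], simp_all)
    qed
    define z where "z = y (n + 2) + 2 ^ n * (2 * e + 1) - k0"
    define h where "h = z + 2 ^ (n + 2) * \<bar>c - z\<bar>"
    have kh: "k0 + h = y (n + 2) + 2 ^ n * (2 * (e + 2 * \<bar>c - z\<bar>) + 1)"
      unfolding h_def by (subst z_def) (simp add: algebra_simps power_add)
    have "b (k + h) = a k" if k: "k \<in> {A..<A + int L}" for k
    proof (cases "k = k0")
      case True
      then show ?thesis using kh e by metis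
    next
      case False
      have dx: "2 ^ Suc L dvd k0 - x (Suc L)"
        using dvd_add[OF k0(2) fold_structure_dvd[OF a, of n "Suc n"]] by (simp add: n_def)
      have dy: "2 ^ Suc L dvd k0 + h - y (Suc L)"
      proof -
        have "2 ^ n dvd (k0 + h - y (n + 2)) + (y (n + 2) - y n)"
          using kh by (intro dvd_add fold_structure_dvd[OF b]) simp_all
        then show ?thesis by (simp add: n_def algebra_simps)
      qed
      show ?thesis
      proof (rule fold_structure_cong[OF a b, of L])
        show "\<not> 2 ^ L dvd k - x (Suc L)"
        proof
          assume "2 ^ L dvd k - x (Suc L)"
          moreover have "2 ^ L dvd k0 - x (Suc L)" using dx by (meson dvd_trans le_imp_power_dvd lessI less_imp_le)
          ultimately have "2 ^ L dvd (k - x (Suc L)) - (k0 - x (Suc L))" by (rule dvd_diff)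
          then have "2 ^ L dvd k - k0" by simp
          then have "\<bar>2 ^ L\<bar> \<le> \<bar>k - k0\<bar>" using False by (intro dvd_imp_le_int) auto
          then show False using L k k0(1) unfolding atLeastLessThan_iff by linarith
        qed
        have "2 ^ Suc L dvd (k0 + h - y (Suc L)) - (k0 - x (Suc L))"
          using dvd_diff[OF dy dx] .
        moreover have "k + h - y (Suc L) - (k - x (Suc L)) = (k0 + h - y (Suc L)) - (k0 - x (Suc L))"
          by simp
        ultimately show "2 ^ Suc L dvd k + h - y (Suc L) - (k - x (Suc L))" by metis
      qed
    qed
    moreover have "h \<ge> c" unfolding h_def by (rule big)
    ultimately show ?thesis by blast
  qed
qed

lemma fold_structure_subword:
  assumes a: "fold_structure \<eta> x a" and b: "fold_structure \<eta> y b" and u: "subword u a"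
  shows "subword u b"
proof -
  obtain h where h: "\<forall>k<length u. u ! k = a (int k + h)" using u unfolding subword_def by blast
  obtain h' where h': "\<forall>k\<in>{h..<h + int (length u)}. b (k + h') = a k"
    using fold_structure_window[OF a b, of 0 h "length u"] by blast
  have "u ! k = b (int k + (h + h'))" if "k < length u" for k
    using h h'[rule_format, of "int k + h"] that by (simp add: add.assoc)
  then show ?thesis unfolding subword_def by blast
qed

lemma fold_structure_locally_isomorphic:
  assumes "fold_structure \<eta> x a" and "fold_structure \<eta> y b"
  shows "locally_isomorphic a b"
  using assms fold_structure_subword unfolding locally_isomorphic_def by blast

section \<open>Recovering centre and signs from a finite window\<close>

lemma residue_in_window:
  fixes z :: int
  obtains s where "0 \<le> z + 2 ^ n * s" "z + 2 ^ n * s < 2 ^ n"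
proof (rule that[of "- (z div 2 ^ n)"])
  have "z + 2 ^ n * - (z div 2 ^ n) = z mod 2 ^ n"
    by (simp add: minus_mult_div_eq_mod[symmetric])
  then show "0 \<le> z + 2 ^ n * - (z div 2 ^ n)" "z + 2 ^ n * - (z div 2 ^ n) < 2 ^ n" by simp_all
qed

text \<open>If the centres differed first at bit \<open>n\<close>, a progression with step \<open>2 ^ (n + 2)\<close> would be
  constant according to one structure and alternating according to the other.\<close>

lemma fold_structure_centre_unique:
  assumes a: "fold_structure \<eta> x a" and b: "fold_structure \<eta>' x' b"
    and eq: "\<forall>k\<in>{0..<2 ^ (n + 3)}. a k = b k"
  shows "2 ^ n dvd x n - x' n"
  using eq
proof (induction n)
  case (Suc n)
  have "(2::int) ^ (n + 3) \<le> 2 ^ (Suc n + 3)" by (intro power_increasing) auto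
  then have "\<forall>k\<in>{0..<2 ^ (n + 3)}. a k = b k" using Suc.prems
    by (meson atLeastLessThan_iff less_le_trans)
  then have IH: "2 ^ n dvd x n - x' n" by (rule Suc.IH)
  let ?X = "x (n + 3)" and ?X' = "x' (n + 3)"
  have "2 ^ n dvd (?X - x n) + (x n - x' n) - (?X' - x' n)"
    by (intro dvd_add dvd_diff IH fold_structure_dvd[OF a] fold_structure_dvd[OF b]) auto
  then obtain w where w: "?X - ?X' = 2 ^ n * w" by (auto elim: dvdE)
  have "even w"
  proof (rule ccontr)
    assume "odd w"
    then obtain t where t: "w = 2 * t + 1" by (auto elim: oddE)
    obtain s where s: "0 \<le> ?X + 2 ^ (n + 1) + 2 ^ (n + 3) * s"
        "?X + 2 ^ (n + 1) + 2 ^ (n + 3) * s < 2 ^ (n + 3)"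
      using residue_in_window .
    \<comment> \<open>Relative to \<open>x\<close> this point has valuation \<open>n + 1\<close>, so
      adding \<open>2 ^ (n + 2)\<close> raises \<open>m\<close> by 1. Relative to \<open>x'\<close>
      the odd \<open>w\<close> gives valuation \<open>n\<close>, and \<open>m\<close> rises by
      2.\<close>
    define k where "k = ?X + 2 ^ (n + 1) + 2 ^ (n + 3) * s"
    have "k = ?X + 2 ^ (n + 1) * (2 * (2 * s) + 1)"
      "k + 2 ^ (n + 2) = ?X + 2 ^ (n + 1) * (2 * (2 * s + 1) + 1)"
      unfolding k_def by (simp_all add: algebra_simps power_add)
    from this[THEN fold_structure_value[OF a, rotated]]
    have "a k = \<eta> (n + 1)" "a (k + 2 ^ (n + 2)) = - \<eta> (n + 1)" by simp_all
    moreover have "k = ?X' + 2 ^ n * (2 * (t + 1 + 4 * s) + 1)"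
      "k + 2 ^ (n + 2) = ?X' + 2 ^ n * (2 * (t + 1 + 4 * s + 2) + 1)"
      using w unfolding k_def t by (simp_all add: algebra_simps power_add)
    from this[THEN fold_structure_value[OF b, rotated]]
    have "b k = b (k + 2 ^ (n + 2))" by simp
    moreover have "k \<in> {0..<2 ^ (Suc n + 3)}" "k + 2 ^ (n + 2) \<in> {0..<2 ^ (Suc n + 3)}"
      using s unfolding k_def[symmetric] by (auto simp: power_add)
    ultimately have "\<eta> (n + 1) = - \<eta> (n + 1)" using Suc.prems by metis
    then show False using fold_structure_sign(1)[OF a, of "n + 1"] by auto
  qed
  then have "2 ^ Suc n dvd ?X - ?X'" using w by (auto simp: mult.assoc elim!: evenE)
  then have "2 ^ Suc n dvd (?X - ?X') - (?X - x (Suc n)) + (?X' - x' (Suc n))"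
    using fold_structure_dvd[OF a, of "Suc n" "n + 3"] fold_structure_dvd[OF b, of "Suc n" "n + 3"]
    by (meson dvd_add dvd_diff Suc_le_eq less_add_same_cancel1 zero_less_numeral)
  then show ?case by (simp add: algebra_simps)
qed simp

text \<open>The centres agree modulo \<open>2 ^ n\<close>, so a point congruent to
  \<open>x n + 2 ^ j\<close> has valuation \<open>j\<close> and even \<open>m\<close> for both
  structures. Its value is then both \<open>\<eta> j\<close> and \<open>\<eta>' j\<close>.\<close>

lemma fold_structure_sign_unique:
  assumes a: "fold_structure \<eta> x a" and b: "fold_structure \<eta>' x' b"
    and eq: "\<forall>k\<in>{0..<2 ^ (n + 3)}. a k = b k" and j: "j + 2 \<le> n"
  shows "\<eta> j = \<eta>' j"
proof -
  obtain t where t: "x n - x' n = 2 ^ n * t"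
    using fold_structure_centre_unique[OF a b eq] by blast
  obtain s where s: "0 \<le> (x n + 2 ^ j) + 2 ^ n * s" "(x n + 2 ^ j) + 2 ^ n * s < 2 ^ n"
    using residue_in_window .
  define k where "k = (x n + 2 ^ j) + 2 ^ n * s"
  obtain d where d: "n = j + 2 + d" using j le_Suc_ex by blast
  have "k = x n + 2 ^ j * (2 * (2 * (2 ^ d * s)) + 1)"
    unfolding k_def by (simp add: d algebra_simps power_add)
  from fold_structure_value[OF a j this] have "a k = \<eta> j" by simp
  moreover have "k = x' n + 2 ^ j * (2 * (2 * (2 ^ d * (s + t))) + 1)"
    using t unfolding k_def by (simp add: d algebra_simps power_add)
  from fold_structure_value[OF b j this] have "b k = \<eta>' j" by simp
  moreover have "k \<in> {0..<2 ^ (n + 3)}"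
  proof -
    have "(2::int) ^ n \<le> 2 ^ (n + 3)" by (intro power_increasing) auto
    then show ?thesis using s unfolding k_def[symmetric] by (meson atLeastLessThan_iff less_le_trans)
  qed
  ultimately show ?thesis using eq by metis
qed

text \<open>A subword of length \<open>2 ^ (j + 5)\<close> determines sign number \<open>j\<close>.
  It reappears in \<open>b\<close> after a shift, which alters the centre but not the signs.\<close>

lemma locally_isomorphic_sign_eq:
  assumes a: "fold_structure \<eta> x a" and b: "fold_structure \<eta>' x' b"
    and iso: "locally_isomorphic a b"
  shows "\<eta> = \<eta>'"
proof
  fix j
  define L :: nat where "L = 2 ^ (j + 2 + 3)"
  define u where "u = map (\<lambda>k. a (int k)) [0..<L]"
  have "subword u a" unfolding subword_def u_def by (intro exI[of _ 0]) simp
  with iso have "subword u b" unfolding locally_isomorphic_def by blast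
  then obtain h where h: "\<forall>k<L. a (int k) = b (int k + h)"
    unfolding subword_def u_def by auto
  have "\<forall>k\<in>{0..<2 ^ (j + 2 + 3)}. a k = b (k + h)"
  proof
    fix k :: int assume k: "k \<in> {0..<2 ^ (j + 2 + 3)}"
    then have "int (nat k) = k" "int (nat k) < int L" unfolding L_def by auto
    then show "a k = b (k + h)" using h by (metis of_nat_less_iff)
  qed
  then show "\<eta> j = \<eta>' j"
    using fold_structure_sign_unique[OF a fold_structure_shift[OF b]] by blast
qed

section \<open>Folding sequences as blocks of structures with centre 0\<close>

text \<open>Leaving out both end points \<open>c\<close> and \<open>c + 2 ^ n\<close> gives the
  length \<open>2 ^ n - 1\<close> of an \<open>n\<close>-folding sequence.\<close>

definition block :: "(int \<Rightarrow> int) \<Rightarrow> int \<Rightarrow> nat \<Rightarrow> int list" where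
  "block a c n = map (\<lambda>i. a (c + int i)) [1..<2 ^ n]"

lemma length_block: "length (block a c n) = 2 ^ n - 1"
  by (simp add: block_def)

lemma nth_block: "i < 2 ^ n - 1 \<Longrightarrow> block a c n ! i = a (c + 1 + int i)"
  by (simp add: block_def algebra_simps)

text \<open>The position \<open>c + 2 ^ n\<close> is the middle of the longer block; antisymmetry
  about it is the folding recursion.\<close>

lemma block_Suc:
  assumes "\<And>i. 0 < i \<Longrightarrow> i < 2 ^ n \<Longrightarrow> a (c + 2 ^ n - i) = - a (c + 2 ^ n + i)"
  shows "block a c (Suc n) = fold_bar (block a (c + 2 ^ n) n) @ [a (c + 2 ^ n)] @ block a (c + 2 ^ n) n"
proof -
  have "[1..<2 ^ Suc n] = [1..<2 ^ n] @ [2 ^ n] @ map (\<lambda>i. i + 2 ^ n) [1..<2 ^ n :: nat]"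
  proof -
    have "[1..<2 ^ n + 2 ^ n] = [1..<2 ^ n] @ [2 ^ n..<2 ^ n + 2 ^ n :: nat]"
      by (rule upt_add_eq_append) simp
    moreover have "[2 ^ n..<2 ^ n + 2 ^ n] = 2 ^ n # [1 + 2 ^ n..<2 ^ n + 2 ^ n :: nat]"
      by (simp add: upt_conv_Cons)
    moreover have "[1 + 2 ^ n..<2 ^ n + 2 ^ n] = map (\<lambda>i. i + 2 ^ n) [1..<2 ^ n :: nat]"
      by (rule nth_equalityI) simp_all
    ultimately show ?thesis by (simp add: mult_2)
  qed
  moreover have "map (\<lambda>i. a (c + int i)) [1..<2 ^ n] = fold_bar (block a (c + 2 ^ n) n)"
  proof (rule nth_equalityI)
    fix i assume "i < length (map (\<lambda>i. a (c + int i)) [1..<2 ^ n])"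
    then have i: "i < 2 ^ n - 1" by simp
    then have "fold_bar (block a (c + 2 ^ n) n) ! i = - block a (c + 2 ^ n) n ! (2 ^ n - 1 - Suc i)"
      by (simp add: fold_bar_def length_block rev_nth)
    also have "\<dots> = - a (c + 2 ^ n + 1 + int (2 ^ n - 1 - Suc i))"
      using i by (subst nth_block) auto
    also have "c + 2 ^ n + 1 + int (2 ^ n - 1 - Suc i) = c + 2 ^ n + (2 ^ n - 1 - int i)"
      using i by (simp add: of_nat_diff)
    also have "- a \<dots> = a (c + 2 ^ n - (2 ^ n - 1 - int i))"
    proof -
      have "int i < int (2 ^ n - 1)" using i by (simp only: of_nat_less_iff)
      then show ?thesis by (subst assms) (simp_all add: of_nat_diff)
    qed
    finally show "map (\<lambda>i. a (c + int i)) [1..<2 ^ n] ! i = fold_bar (block a (c + 2 ^ n) n) ! i"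
      using i by (simp add: algebra_simps)
  qed (simp add: fold_bar_def length_block)
  ultimately show ?thesis by (simp add: block_def o_def algebra_simps)
qed

text \<open>Both points inherit the valuation \<open>j < n\<close> of \<open>i\<close>. The numbers
  \<open>w - m - 1\<close> and \<open>w + m\<close> that decide their signs have an odd sum, hence
  opposite parities.\<close>

lemma fold_structure_reflect:
  assumes a: "fold_structure \<eta> (\<lambda>_. 0) a" and i: "0 < i" "i < 2 ^ n"
  shows "a (2 ^ n * (2 * q + 1) - i) = - a (2 ^ n * (2 * q + 1) + i)"
proof -
  have "\<not> 2 ^ n dvd i" using i zdvd_not_zless by blast
  then obtain j m where jm: "j < n" "i = 2 ^ j * (2 * m + 1)" by (rule two_power_decompose)
  obtain d where d: "n = Suc j + d" using jm(1) less_iff_Suc_add by auto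
  define w where "w = 2 ^ d * (2 * q + 1)"
  have "2 ^ n * (2 * q + 1) - i = 0 + 2 ^ j * (2 * (w - m - 1) + 1)"
    "2 ^ n * (2 * q + 1) + i = 0 + 2 ^ j * (2 * (w + m) + 1)"
    unfolding w_def by (simp_all add: jm d algebra_simps power_add)
  from this[THEN fold_structure_value[OF a le_refl]] show ?thesis by auto
qed

text \<open>All multiples of \<open>2 ^ n\<close> are treated at once because the right half of the
  block at \<open>2 ^ Suc n * q\<close> starts at the odd multiple
  \<open>2 ^ n * (2 * q + 1)\<close>.\<close>

lemma block_in_folding_sequences:
  assumes a: "fold_structure \<eta> (\<lambda>_. 0) a"
  shows "block a (2 ^ n * q) n \<in> folding_sequences n"
proof (induction n arbitrary: q)
  case 0
  show ?case by (simp add: block_def)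
next
  case (Suc n)
  have c: "2 ^ Suc n * q + 2 ^ n = 2 ^ n * (2 * q + 1)" by (simp add: algebra_simps)
  have "block a (2 ^ Suc n * q) (Suc n) = fold_bar (block a (2 ^ n * (2 * q + 1)) n) @
      [a (2 ^ n * (2 * q + 1))] @ block a (2 ^ n * (2 * q + 1)) n"
    using block_Suc[of n a "2 ^ Suc n * q"] fold_structure_reflect[OF a, where q = q] unfolding c by blast
  moreover have "a (2 ^ n * (2 * q + 1)) \<in> {1, -1}" using fold_structure_sign(2)[OF a] by auto
  ultimately show ?case using Suc.IH[of "2 * q + 1"] by auto
qed

lemma folding_sequence_eq_block:
  assumes "S \<in> folding_sequences n"
  shows "\<exists>\<eta> a. fold_structure \<eta> (\<lambda>_. 0) a \<and> S = block a (2 ^ n * q) n"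
  using assms
proof (induction n arbitrary: S q)
  case 0
  have "\<exists>a. fold_structure (\<lambda>_. 1) (\<lambda>_. 0) a" by (rule fold_structure_exists) auto
  with 0 show ?case by (auto simp: block_def)
next
  case (Suc n)
  then obtain T e where T: "S = fold_bar T @ [e] @ T" "T \<in> folding_sequences n" "e \<in> {1, -1}"
    by auto
  define c where "c = 2 ^ n * (2 * q + 1)"
  have c: "2 ^ Suc n * q + 2 ^ n = c" by (simp add: c_def algebra_simps)
  obtain \<eta> a where a: "fold_structure \<eta> (\<lambda>_. 0) a" and Ta: "T = block a c n"
    using Suc.IH[OF T(2)] unfolding c_def by blast
  \<comment> \<open>Only the midpoint \<open>c\<close> of the new block has valuation
    \<open>n\<close>, so sign \<open>n\<close> can be reset without disturbing the halves. The
    parity of \<open>q\<close> compensates for the alternation.\<close>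
  define \<eta>' where "\<eta>' = \<eta>(n := if even q then e else - e)"
  have "range \<eta>' \<subseteq> {1, -1}"
    using fold_structure_sign(1)[OF a] T(3) by (auto simp: \<eta>'_def)
  then obtain b where b: "fold_structure \<eta>' (\<lambda>_. 0) b"
    using fold_structure_exists[of \<eta>' "\<lambda>_. 0"] by auto
  have "b c = e"
    using fold_structure_value[OF b, of n "n + 2" c q] by (auto simp: c_def \<eta>'_def)
  moreover have "block b c n = block a c n"
  proof -
    have "b (c + int i) = a (c + int i)" if "i \<in> {1..<2 ^ n}" for i
    proof -
      have "int i < 2 ^ n" using that by auto
      then have "\<not> 2 ^ n dvd int i" using that zdvd_not_zless by auto
      then have "\<not> 2 ^ n dvd c + int i"
        unfolding c_def by (metis dvd_add_right_iff dvd_triv_left)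
      then obtain j m where jm: "j < n" "c + int i = 2 ^ j * (2 * m + 1)"
        by (rule two_power_decompose)
      then have "\<eta>' j = \<eta> j" by (simp add: \<eta>'_def)
      with jm(2) fold_structure_value[OF a le_refl, of "c + int i" j m]
        fold_structure_value[OF b le_refl, of "c + int i" j m]
      show ?thesis by simp
    qed
    then show ?thesis by (simp add: block_def)
  qed
  moreover have "block b (2 ^ Suc n * q) (Suc n) = fold_bar (block b c n) @ [b c] @ block b c n"
    using block_Suc[of n b "2 ^ Suc n * q"] fold_structure_reflect[OF b, where q = q]
    unfolding c unfolding c_def by blast
  ultimately show ?case using b T(1) Ta by metis
qed

section \<open>Complete folding sequences are exactly the sequences with a structure\<close>

text \<open>A subword also occurs in the structure with the same signs and centre 0. The lower bound
  on the shift places it at positions from 1 on, inside a long block starting at 0.\<close>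

lemma fold_structure_complete:
  assumes a: "fold_structure \<eta> x a"
  shows "complete_folding_sequence a"
  unfolding complete_folding_sequence_def
proof (intro conjI allI impI)
  show "a \<in> sign_sequences" using a unfolding fold_structure_def by blast
  fix u assume "subword u a"
  then obtain A where A: "\<forall>k<length u. u ! k = a (int k + A)" unfolding subword_def by blast
  obtain b where b: "fold_structure \<eta> (\<lambda>_. 0) b"
    using fold_structure_exists[of \<eta> "\<lambda>_. 0"] a unfolding fold_structure_def by auto
  obtain h where h: "h \<ge> 1 - A" "\<forall>k\<in>{A..<A + int (length u)}. b (k + h) = a k"
    using fold_structure_window[OF a b] by blast
  define p where "p = nat (A + h - 1)"
  have p: "int p = A + h - 1" unfolding p_def using h(1) by simp
  define n where "n = p + length u + 1"
  define T where "T = block b 0 n"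
  have n: "p + length u + 1 < 2 ^ n" unfolding n_def by (rule less_exp)
  have "u = take (length u) (drop p T)"
  proof (rule nth_equalityI)
    show "length u = length (take (length u) (drop p T))" using n by (simp add: T_def length_block)
    fix i assume i: "i < length u"
    then have "take (length u) (drop p T) ! i = b (1 + int (p + i))"
      using n by (simp add: T_def length_block nth_block)
    also have "\<dots> = b ((int i + A) + h)" using p by (intro arg_cong[of _ _ b]) simp
    also have "\<dots> = u ! i" using h(2) A i by simp
    finally show "u ! i = take (length u) (drop p T) ! i" ..
  qed
  then have "T = take p T @ u @ drop (length u) (drop p T)"
    by (metis append_take_drop_id)
  then have "sublist u T" unfolding sublist_def by blast
  moreover have "T \<in> folding_sequences n"
    using block_in_folding_sequences[OF b, of n 0] by (simp add: T_def)
  ultimately show "\<exists>n. \<exists>S\<in>folding_sequences n. sublist u S" by blast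
qed

text \<open>The window lies in a folding sequence, hence in a block with centre 0; its offset there
  becomes the integer centre.\<close>

lemma complete_folding_sequence_window:
  assumes "complete_folding_sequence S"
  shows "\<exists>\<eta> z a. fold_structure \<eta> (\<lambda>_. z) a \<and> (\<forall>k. \<bar>k\<bar> \<le> int M \<longrightarrow> S k = a k)"
proof -
  define u where "u = map (\<lambda>i. S (int i - int M)) [0..<2 * M + 1]"
  have "subword u S"
    unfolding subword_def u_def by (intro exI[of _ "- int M"]) (simp del: upt_Suc)
  then obtain n T where T: "T \<in> folding_sequences n" "sublist u T"
    using assms unfolding complete_folding_sequence_def by blast
  obtain \<eta> a where a: "fold_structure \<eta> (\<lambda>_. 0) a" and Ta: "T = block a 0 n"
    using folding_sequence_eq_block[OF T(1), of 0] by auto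
  obtain ps ss where ps: "T = ps @ u @ ss" using T(2) unfolding sublist_def by blast
  \<comment> \<open>The window starts at position \<open>- int M\<close> of \<open>S\<close>, and
    \<open>block a 0 n\<close> starts at position 1.\<close>
  define h where "h = int M + 1 + int (length ps)"
  have "S k = a (k + h)" if k: "\<bar>k\<bar> \<le> int M" for k
  proof -
    define i where "i = nat (k + int M)"
    have i: "int i = k + int M" "i < 2 * M + 1" unfolding i_def using k by auto
    have "length ps + i < length T" using i(2) by (simp add: ps u_def)
    then have "T ! (length ps + i) = a (1 + int (length ps + i))"
      unfolding Ta by (simp add: length_block nth_block)
    moreover have "T ! (length ps + i) = u ! i" using i(2) by (simp add: ps u_def nth_append)
    moreover have "u ! i = S k" using i by (simp add: u_def del: upt_Suc)
    moreover have "1 + int (length ps + i) = k + h" using i(1) by (simp add: h_def)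
    ultimately show ?thesis by metis
  qed
  with fold_structure_shift[OF a, of h] show ?thesis by blast
qed

text \<open>The integer centres of the approximations to growing windows need not stabilise. By the
  uniqueness lemmas they are coherent, so they define a 2-adic centre, and sign \<open>j\<close> is
  constant from window \<open>j + 2\<close> on.\<close>

lemma complete_folding_sequence_structure:
  assumes S: "complete_folding_sequence S"
  obtains \<eta> x where "fold_structure \<eta> x S"
proof -
  have "\<forall>N. \<exists>\<eta> z a. fold_structure \<eta> (\<lambda>_. z) a \<and> (\<forall>k. \<bar>k\<bar> \<le> 2 ^ (N + 3) \<longrightarrow> S k = a k)"
    using complete_folding_sequence_window[OF S] by (metis of_nat_numeral of_nat_power)
  then obtain E x B where fs: "fold_structure (E N) (\<lambda>_. x N) (B N)"
    and SB: "\<And>k. \<bar>k\<bar> \<le> 2 ^ (N + 3) \<Longrightarrow> S k = B N k" for N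
    by metis
  have agree: "\<forall>k\<in>{0..<2 ^ (n + 3)}. B N k = B n k" if "n \<le> N" for n N
  proof
    fix k :: int assume k: "k \<in> {0..<2 ^ (n + 3)}"
    have "(2::int) ^ (n + 3) \<le> 2 ^ (N + 3)" using that by (intro power_increasing) auto
    with k have "\<bar>k\<bar> \<le> 2 ^ (n + 3)" "\<bar>k\<bar> \<le> 2 ^ (N + 3)"
      by (auto simp del: power_increasing_iff)
    then show "B N k = B n k" using SB by metis
  qed
  have x: "2 ^ n dvd x N - x n" if "n \<le> N" for n N
    using fold_structure_centre_unique[OF fs fs agree[OF that]] .
  have E: "E N j = E (j + 2) j" if "j + 2 \<le> N" for j N
    using fold_structure_sign_unique[OF fs fs agree[OF that]] by blast
  have "fold_structure (\<lambda>j. E (j + 2) j) x S"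
    unfolding fold_structure_def
  proof (intro conjI allI)
    show "range (\<lambda>j. E (j + 2) j) \<subseteq> {1, - 1}" using fold_structure_sign(1)[OF fs] by auto
    show "2 ^ n dvd x (Suc n) - x n" for n by (rule x) simp
    show "S \<in> sign_sequences" using S unfolding complete_folding_sequence_def by blast
    fix j m
    define k where "k = x (j + 2) + 2 ^ j * (2 * m + 1)"
    \<comment> \<open>Large enough for sign \<open>j\<close> to be final and for the window to
      contain \<open>k\<close>.\<close>
    define N where "N = j + 2 + nat \<bar>k\<bar>"
    have "int (nat \<bar>k\<bar>) < 2 ^ nat \<bar>k\<bar>" using of_nat_less_two_power by blast
    also have "\<dots> \<le> 2 ^ (N + 3)" unfolding N_def by (intro power_increasing) auto
    finally have "S k = B N k" by (intro SB) simp
    moreover have "2 ^ (j + 2) dvd x N - x (j + 2)" by (rule x) (simp add: N_def)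
    then obtain t where t: "x N - x (j + 2) = 2 ^ (j + 2) * t" by blast
    have "k = x N + 2 ^ j * (2 * (m - 2 * t) + 1)"
      using t unfolding k_def by (simp add: algebra_simps power_add)
    then have "B N k = (if even (m - 2 * t) then E N j else - E N j)"
      by (intro fold_structure_value[OF fs le_refl])
    ultimately show "S (x (j + 2) + 2 ^ j * (2 * m + 1)) =
        (if even m then E (j + 2) j else - E (j + 2) j)"
      using E[of j N] unfolding k_def[symmetric] by (simp add: N_def)
  qed
  then show ?thesis by (rule that)
qed

section \<open>A continuum of centres with non-integer differences\<close>

text \<open>Every digit of \<open>A\<close> is repeated infinitely often, and the base-4 digits 0 and 1 leave no room
  for infinite carries, so distinct sets give centres whose difference is not an integer.\<close>

definition centre :: "nat set \<Rightarrow> nat \<Rightarrow> int" where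
  "centre A n = (\<Sum>i<n. 4 ^ i * of_bool (fst (prod_decode i) \<in> A))"

lemma centre_Suc: "centre A (Suc n) = centre A n + 4 ^ n * of_bool (fst (prod_decode n) \<in> A)"
  by (simp add: centre_def)

lemma centre_bounds: "0 \<le> centre A n" "3 * centre A n < 4 ^ n"
proof -
  have "0 \<le> centre A n \<and> 3 * centre A n < 4 ^ n"
    by (induction n) (simp_all add: centre_def)
  then show "0 \<le> centre A n" "3 * centre A n < 4 ^ n" by simp_all
qed

lemma four_power_dvd_centre:
  assumes "n \<le> N"
  shows "4 ^ n dvd centre A N - centre A n"
  using assms
proof (induction N rule: dec_induct)
  case (step i)
  have "(4::int) ^ n dvd 4 ^ i" using step.hyps(1) by (rule le_imp_power_dvd)
  then have "4 ^ n dvd (centre A i - centre A n) + 4 ^ i * of_bool (fst (prod_decode i) \<in> A)"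
    using step.IH by (intro dvd_add dvd_mult2)
  then show ?case by (simp add: centre_Suc algebra_simps)
qed simp

lemma centre_coherent: "2 ^ n dvd centre A (Suc n) - centre A n"
proof -
  have "(2::int) ^ n dvd 4 ^ n" by (rule dvd_power_same) simp
  then show ?thesis by (simp add: centre_Suc)
qed

text \<open>The hypothesis at \<open>2 * n\<close> is a congruence modulo \<open>4 ^ n\<close>. Both
  centres lie between 0 and a third of \<open>4 ^ n\<close>, so for large \<open>n\<close> the
  congruence is an equality, and successive equalities compare the digits.\<close>

lemma centre_inj:
  assumes "\<And>n. 2 ^ n dvd centre A n - centre B n - k"
  shows "A = B"
proof -
  have eq: "centre A n - centre B n = k" if n: "nat (3 * \<bar>k\<bar>) \<le> n" for n
  proof (rule ccontr)
    assume ne: "centre A n - centre B n \<noteq> k"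
    have "(4::int) ^ n = 2 ^ (2 * n)" by (simp add: power_mult)
    then have "4 ^ n dvd (centre A (2 * n) - centre B (2 * n) - k)
        - (centre A (2 * n) - centre A n) + (centre B (2 * n) - centre B n)"
      using assms[of "2 * n"]
      by (intro dvd_add[OF dvd_diff] four_power_dvd_centre) auto
    then have "4 ^ n dvd centre A n - centre B n - k" by (simp add: algebra_simps)
    then have "\<bar>4 ^ n\<bar> \<le> \<bar>centre A n - centre B n - k\<bar>" using ne by (intro dvd_imp_le_int) auto
    moreover have "int n < 2 ^ n" by (rule of_nat_less_two_power)
    moreover have "(2::int) ^ n \<le> 4 ^ n" by (rule power_mono) auto
    moreover have "3 * \<bar>k\<bar> \<le> int n" using n by simp
    ultimately show False
      using centre_bounds[of A n] centre_bounds[of B n] by linarith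
  qed
  have "i \<in> A \<longleftrightarrow> i \<in> B" for i
  proof -
    \<comment> \<open>A position that repeats digit \<open>i\<close> beyond the threshold from which
      the difference equals \<open>k\<close>.\<close>
    define m where "m = prod_encode (i, nat (3 * \<bar>k\<bar>))"
    have m: "nat (3 * \<bar>k\<bar>) \<le> m" unfolding m_def by (rule le_prod_encode_2)
    then have "centre A (Suc m) - centre B (Suc m) = centre A m - centre B m"
      using eq[of m] eq[of "Suc m"] by simp
    then have "of_bool (i \<in> A) = (of_bool (i \<in> B) :: int)"
      by (simp add: centre_Suc m_def)
    then show ?thesis by (simp split: if_splits add: of_bool_def)
  qed
  then show ?thesis by blast
qed

section \<open>Isomorphism classes and cardinalities\<close>

lemma equiv_isomorphic_rel: "equiv UNIV isomorphic_rel"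
proof (rule equivI)
  show "refl isomorphic_rel"
    unfolding refl_on_def isomorphic_rel_def by (auto intro: exI[of _ 0])
  show "sym isomorphic_rel"
  proof (rule symI)
    fix a b assume "(a, b) \<in> isomorphic_rel"
    then obtain k where "\<forall>h. b h = a (h + k)" unfolding isomorphic_rel_def by auto
    then have "\<forall>h. a h = b (h + - k)" by simp
    then show "(b, a) \<in> isomorphic_rel" unfolding isomorphic_rel_def by blast
  qed
  show "trans isomorphic_rel"
  proof (rule transI)
    fix a b c assume "(a, b) \<in> isomorphic_rel" "(b, c) \<in> isomorphic_rel"
    then obtain k l where "\<forall>h. b h = a (h + k)" "\<forall>h. c h = b (h + l)"
      unfolding isomorphic_rel_def by blast
    then have "\<forall>h. c h = a (h + (l + k))" by (simp add: add.assoc)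
    then show "(a, c) \<in> isomorphic_rel" unfolding isomorphic_rel_def by blast
  qed
qed simp

lemma sign_sequences_lepoll: "sign_sequences \<lesssim> (UNIV :: nat set set)"
proof -
  have "inj_on (\<lambda>a. {n. a (int_decode n) = 1}) sign_sequences"
  proof (rule inj_onI)
    fix a b assume ab: "a \<in> sign_sequences" "b \<in> sign_sequences"
      and eq: "{n. a (int_decode n) = 1} = {n. b (int_decode n) = 1}"
    show "a = b"
    proof
      fix k
      have "a (int_decode (int_encode k)) = 1 \<longleftrightarrow> b (int_decode (int_encode k)) = 1"
        using eq by blast
      moreover have "a k \<in> {1, -1}" "b k \<in> {1, -1}"
        using ab unfolding sign_sequences_def by blast+
      ultimately show "a k = b k" by auto
    qed
  qed
  then show ?thesis unfolding lepoll_def by blast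
qed

theorem theorem1p11:
  shows "(\<exists>F :: (int \<Rightarrow> int) set.
            F \<approx> (UNIV :: nat set set) \<and>
            (\<forall>a\<in>F. complete_folding_sequence a) \<and>
            pairwise (\<lambda>a b. \<not> locally_isomorphic a b) F) \<and>
         (\<forall>S :: int \<Rightarrow> int. complete_folding_sequence S \<longrightarrow>
            {b \<in> sign_sequences. locally_isomorphic b S} // isomorphic_rel \<approx> (UNIV :: nat set set))"
proof (intro conjI allI impI)
  define sgn_of :: "nat set \<Rightarrow> nat \<Rightarrow> int" where "sgn_of A j = (if j \<in> A then 1 else -1)" for A j
  have sgn_inj: "A = B" if "sgn_of A = sgn_of B" for A B
  proof -
    have "j \<in> A \<longleftrightarrow> j \<in> B" for j using fun_cong[OF that, of j] by (auto simp: sgn_of_def split: if_splits)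
    then show ?thesis by blast
  qed
  have "\<exists>a. fold_structure (sgn_of A) (\<lambda>_. 0) a" for A
    by (rule fold_structure_exists) (auto simp: sgn_of_def)
  then obtain f where f: "\<And>A. fold_structure (sgn_of A) (\<lambda>_. 0) (f A)" by metis
  have noniso: "A = B" if "locally_isomorphic (f A) (f B)" for A B
    using locally_isomorphic_sign_eq[OF f f that] by (rule sgn_inj)
  have "inj f"
    by (rule injI) (rule noniso, simp add: locally_isomorphic_def)
  then have "range f \<approx> (UNIV :: nat set set)" by (rule inj_on_image_eqpoll_self)
  moreover have "\<forall>a\<in>range f. complete_folding_sequence a" using fold_structure_complete[OF f] by blast
  moreover have "pairwise (\<lambda>a b. \<not> locally_isomorphic a b) (range f)"
    using noniso unfolding pairwise_def by blast
  ultimately show "\<exists>F :: (int \<Rightarrow> int) set. F \<approx> (UNIV :: nat set set) \<and>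
      (\<forall>a\<in>F. complete_folding_sequence a) \<and> pairwise (\<lambda>a b. \<not> locally_isomorphic a b) F"
    by blast
next
  fix S assume "complete_folding_sequence S"
  then obtain \<eta> x where S: "fold_structure \<eta> x S" by (rule complete_folding_sequence_structure)
  let ?X = "{b \<in> sign_sequences. locally_isomorphic b S}"
  have "\<exists>b. fold_structure \<eta> (centre A) b" for A
    using S centre_coherent by (intro fold_structure_exists) (auto simp: fold_structure_def)
  then obtain g where g: "\<And>A. fold_structure \<eta> (centre A) (g A)" by metis
  have gX: "g A \<in> ?X" for A
    using g[of A] fold_structure_locally_isomorphic[OF g S] unfolding fold_structure_def by blast
  have "A = B" if "isomorphic_rel `` {g A} = isomorphic_rel `` {g B}" for A B
  proof -
    have "(g A, g B) \<in> isomorphic_rel"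
      using eq_equiv_class[OF that equiv_isomorphic_rel] by simp
    then obtain k where "\<forall>h. g B h = g A (h + k)" unfolding isomorphic_rel_def by blast
    \<comment> \<open>Shifting \<open>g A\<close> by \<open>k\<close> lowers its centre by
      \<open>k\<close>; the result equals \<open>g B\<close>, so the two centres agree
      2-adically.\<close>
    then have "2 ^ n dvd (centre A n - k) - centre B n" for n
      by (intro fold_structure_centre_unique[OF fold_structure_shift[OF g] g]) simp
    then show "A = B" by (intro centre_inj[of A B k]) (simp add: algebra_simps)
  qed
  then have "inj (\<lambda>A. isomorphic_rel `` {g A})" by (rule injI)
  moreover have "range (\<lambda>A. isomorphic_rel `` {g A}) \<subseteq> ?X // isomorphic_rel"
    using gX by (auto intro: quotientI)
  ultimately have "(UNIV :: nat set set) \<lesssim> ?X // isomorphic_rel"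
    unfolding lepoll_def by blast
  moreover have "?X // isomorphic_rel \<lesssim> (UNIV :: nat set set)"
  proof -
    have "?X // isomorphic_rel = (\<lambda>b. isomorphic_rel `` {b}) ` ?X" unfolding quotient_def by blast
    then have "?X // isomorphic_rel \<lesssim> ?X" by (simp add: image_lepoll)
    also have "?X \<lesssim> sign_sequences" by (rule subset_imp_lepoll) blast
    also note sign_sequences_lepoll
    finally show ?thesis .
  qed
  ultimately show "?X // isomorphic_rel \<approx> (UNIV :: nat set set)" by (intro lepoll_antisym)
qed

end
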